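(* Let $n\ge1$, $q$ a prime power, and $\mathcal{F}$ a covering of $[n]$ with no redundant basic set. If there are $A,B\in\mathcal{F}$ with $|A|\neq|B|$, then the $\mathcal{F}$-combinatorial metric does not satisfy the MacWilliams Extension Property.
   Context: For a covering $\mathcal{F}$ of $[n]$ (subsets called basic sets, union $[n]$) and $x\in\mathbb{F}_q^n$, $\mathrm{wt}_{\mathcal{F}}(x)=\min\{|\mathcal{A}|:\mathcal{A}\subset\mathcal{F},\ \mathrm{supp}(x)\subset\bigcup_{A\in\mathcal{A}}A\}$ with $\mathrm{supp}(x)=\{i:x_i\ne0\}$, and $d_{\mathcal{F}}(x,y)=\mathrm{wt}_{\mathcal{F}}(x-y)$. A basic set is redundant if properly contained in another. A local $\mathcal{F}$-equivalence between linear codes $\mathcal{C}_1,\mathcal{C}_2\subset\mathbb{F}_q^n$ is a linear map $t:\mathcal{C}_1\to\mathcal{C}_2$ with $\mathrm{wt}_{\mathcal{F}}(t(c))=\mathrm{wt}_{\mathcal{F}}(c)$ for all $c\in\mathcal{C}_1$. The metric $d_{\mathcal{F}}$ satisfies the MacWilliams Extension Property if for all linear codes $\mathcal{C}_1,\mathcal{C}_2$, every local $\mathcal{F}$-equivalence $t:\mathcal{C}_1\to\mathcal{C}_2$ extends to a linear isometry $T$ of $(\mathbb{F}_q^n,d_{\mathcal{F}})$, i.e. $T(c)=t(c)$ for all $c\in\mathcal{C}_1$. *)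

theory Defs
  imports "HOL-Analysis.Analysis"
begin

text \<open>Ambient space: F_q^n rendered as ('a::{field,finite})^'n with 'n a finite index type
  (so [n] is UNIV :: 'n set, n = CARD('n) >= 1). Scalar multiplication is (*s).\<close>

definition supp :: "('a::zero)^'n \<Rightarrow> 'n set" where
  "supp x = {i. x $ i \<noteq> 0}"

definition is_covering :: "'n set set \<Rightarrow> bool" where
  "is_covering F \<longleftrightarrow> \<Union>F = UNIV"

definition no_redundant :: "'n set set \<Rightarrow> bool" where
  "no_redundant F \<longleftrightarrow> (\<forall>A\<in>F. \<not> (\<exists>B\<in>F. A \<subset> B))"

definition wtF :: "('n::finite) set set \<Rightarrow> ('a::zero)^'n \<Rightarrow> nat" where
  "wtF F x = (LEAST k. \<exists>\<A>. \<A> \<subseteq> F \<and> card \<A> = k \<and> supp x \<subseteq> \<Union>\<A>)"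

definition dF :: "('n::finite) set set \<Rightarrow> ('a::ab_group_add)^'n \<Rightarrow> 'a^'n \<Rightarrow> nat" where
  "dF F x y = wtF F (x - y)"

definition linear_code :: "(('a::field)^('n::finite)) set \<Rightarrow> bool" where
  "linear_code C \<longleftrightarrow> module.subspace ((*s)) C"

definition local_equiv ::
  "('n::finite) set set \<Rightarrow> (('a::field)^'n) set \<Rightarrow> ('a^'n) set \<Rightarrow> ('a^'n \<Rightarrow> 'a^'n) \<Rightarrow> bool" where
  "local_equiv F C1 C2 t \<longleftrightarrow>
     (\<forall>x\<in>C1. \<forall>y\<in>C1. t (x + y) = t x + t y) \<and>
     (\<forall>c. \<forall>x\<in>C1. t (c *s x) = c *s t x) \<and>
     t ` C1 \<subseteq> C2 \<and>
     (\<forall>c\<in>C1. wtF F (t c) = wtF F c)"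

definition linear_isometry :: "('n::finite) set set \<Rightarrow> (('a::field)^'n \<Rightarrow> 'a^'n) \<Rightarrow> bool" where
  "linear_isometry F T \<longleftrightarrow> Vector_Spaces.linear ((*s)) ((*s)) T \<and>
     (\<forall>x y. dF F (T x) (T y) = dF F x y)"

definition MacWilliams_EP :: "('n::finite) set set \<Rightarrow> ('a::{field,finite}) itself \<Rightarrow> bool" where
  "MacWilliams_EP F _ \<longleftrightarrow>
     (\<forall>(C1::('a^'n) set) C2 t. linear_code C1 \<longrightarrow> linear_code C2 \<longrightarrow> local_equiv F C1 C2 t \<longrightarrow>
        (\<exists>T. linear_isometry F T \<and> (\<forall>c\<in>C1. T c = t c)))"

end

theory Submission
  imports Defs
begin

text \<open>Say \<open>|B| < |A|\<close>. Embedding the coordinates of \<open>B\<close> injectively into \<open>A\<close> gives a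
  linear map from vectors supported on \<open>B\<close> to vectors supported on \<open>A\<close>; both spaces consist
  of vectors of weight at most one, so the map is a local \<open>\<F>\<close>-equivalence. Its image misses a
  coordinate \<open>a\<close> of \<open>A\<close>. A linear isometry \<open>T\<close> extending it is bijective, so
  \<open>T u = e\<^sub>a\<close> for some \<open>u\<close> whose support leaves \<open>B\<close>. Adding to \<open>u\<close> a vector supported on
  \<open>B\<close> that fills the zero coordinates of \<open>u\<close> in \<open>B\<close> yields \<open>w\<close> with
  \<open>supp w = B \<union> supp u\<close>, while \<open>T w\<close> is still supported on \<open>A\<close>. Then \<open>w\<close> has weight one,
  so \<open>B \<union> supp u\<close> lies in a basic set, which therefore properly contains \<open>B\<close>.\<close>

definition coord_space :: "'n set \<Rightarrow> (('a::zero)^'n) set" where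
  "coord_space C = {v. supp v \<subseteq> C}"

definition coord_embed :: "('n \<Rightarrow> 'n) \<Rightarrow> 'n set \<Rightarrow> ('a::zero)^'n \<Rightarrow> 'a^'n" where
  "coord_embed f B v = (\<chi> i. if i \<in> f ` B then v $ inv_into B f i else 0)"

lemma supp_eq_empty_iff: "supp x = {} \<longleftrightarrow> x = 0"
  by (auto simp: supp_def vec_eq_iff)

lemma wtF_attained:
  fixes F :: "('n::finite) set set" and x :: "('a::zero)^'n"
  assumes "is_covering F"
  shows "\<exists>\<A>. \<A> \<subseteq> F \<and> card \<A> = wtF F x \<and> supp x \<subseteq> \<Union>\<A>"
  unfolding wtF_def
  by (rule LeastI_ex[where P="\<lambda>k. \<exists>\<A>. \<A> \<subseteq> F \<and> card \<A> = k \<and> supp x \<subseteq> \<Union>\<A>"])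
     (use assms in \<open>auto simp: is_covering_def\<close>)

lemma wtF_eq_0_iff:
  fixes F :: "('n::finite) set set" and x :: "('a::zero)^'n"
  assumes "is_covering F"
  shows "wtF F x = 0 \<longleftrightarrow> x = 0"
proof
  assume "wtF F x = 0"
  then obtain \<A> where "card \<A> = 0" "supp x \<subseteq> \<Union>\<A>"
    using wtF_attained[OF assms, of x] by auto
  then show "x = 0"
    using supp_eq_empty_iff[of x] by (simp add: finite_subset[OF subset_UNIV])
next
  assume "x = 0"
  then have "\<exists>\<A>. \<A> \<subseteq> F \<and> card \<A> = 0 \<and> supp x \<subseteq> \<Union>\<A>"
    by (intro exI[of _ "{}"]) (simp add: supp_eq_empty_iff)
  then show "wtF F x = 0" unfolding wtF_def by (rule Least_eq_0)
qed

lemma wtF_le_1_iff: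
  fixes F :: "('n::finite) set set" and x :: "('a::zero)^'n"
  assumes "is_covering F"
  shows "wtF F x \<le> 1 \<longleftrightarrow> (\<exists>C\<in>F. supp x \<subseteq> C)"
proof
  assume le: "wtF F x \<le> 1"
  obtain \<A> where \<A>: "\<A> \<subseteq> F" "card \<A> = wtF F x" "supp x \<subseteq> \<Union>\<A>"
    using wtF_attained[OF assms] by blast
  show "\<exists>C\<in>F. supp x \<subseteq> C"
  proof (cases "wtF F x = 0")
    case True
    obtain C where "C \<in> F" using assms by (auto simp: is_covering_def)
    with True show ?thesis by (auto simp: wtF_eq_0_iff[OF assms] supp_def)
  next
    case False
    with le \<A>(2) obtain C where "\<A> = {C}" by (metis card_1_singletonE le_antisym less_one not_le)
    with \<A> show ?thesis by auto
  qed
next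
  assume "\<exists>C\<in>F. supp x \<subseteq> C"
  then obtain C where "C \<in> F" "supp x \<subseteq> C" by blast
  then have "\<exists>\<A>. \<A> \<subseteq> F \<and> card \<A> = 1 \<and> supp x \<subseteq> \<Union>\<A>"
    by (intro exI[of _ "{C}"]) auto
  then show "wtF F x \<le> 1" unfolding wtF_def by (rule Least_le)
qed

lemma wtF_coord_space:
  fixes F :: "('n::finite) set set" and x :: "('a::zero)^'n"
  assumes "is_covering F" "C \<in> F" "x \<in> coord_space C"
  shows "wtF F x = (if x = 0 then 0 else 1)"
  using assms wtF_le_1_iff[OF assms(1), of x] wtF_eq_0_iff[OF assms(1), of x]
  by (auto simp: coord_space_def)

lemma linear_code_coord_space: "linear_code (coord_space C :: (('a::field)^('n::finite)) set)"
  unfolding linear_code_def vec.subspace_def coord_space_def supp_def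
  by (auto simp: subset_eq) (metis add.right_neutral)

lemma supp_coord_embed: "supp (coord_embed f B v) \<subseteq> f ` B"
  by (auto simp: coord_embed_def supp_def)

lemma coord_embed_eq_0_iff:
  assumes "inj_on f B" "v \<in> coord_space B"
  shows "coord_embed f B v = 0 \<longleftrightarrow> v = 0"
proof
  assume zero: "coord_embed f B v = 0"
  have "v $ b = 0" if "b \<in> B" for b
  proof -
    have "coord_embed f B v $ f b = v $ b" using that assms(1) by (simp add: coord_embed_def)
    with zero show ?thesis by simp
  qed
  with assms(2) show "v = 0" by (auto simp: coord_space_def supp_def vec_eq_iff)
qed (simp add: coord_embed_def vec_eq_iff)

lemma local_equiv_coord_embed:
  fixes F :: "('n::finite) set set"
  assumes cov: "is_covering F" and "A \<in> F" "B \<in> F" "inj_on f B" "f ` B \<subseteq> A"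
  shows "local_equiv F (coord_space B :: (('a::field)^'n) set) (coord_space A) (coord_embed f B)"
proof -
  have add: "coord_embed f B (x + y) = coord_embed f B x + coord_embed f B y" for x y :: "'a^'n"
    by (simp add: coord_embed_def vec_eq_iff)
  have scale: "coord_embed f B (c *s x) = c *s coord_embed f B x" for c and x :: "'a^'n"
    by (simp add: coord_embed_def vec_eq_iff)
  have image: "coord_embed f B v \<in> coord_space A" for v :: "'a^'n"
    using supp_coord_embed[of f B v] assms(5) by (auto simp: coord_space_def)
  have weight: "wtF F (coord_embed f B c) = wtF F c" if c: "c \<in> coord_space B" for c :: "'a^'n"
    using wtF_coord_space[OF cov assms(2) image] wtF_coord_space[OF cov assms(3) c]
      coord_embed_eq_0_iff[OF assms(4) c] by simp
  show ?thesis
    unfolding local_equiv_def using add scale image weight by blast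
qed

lemma linear_isometry_preserves_wtF:
  assumes "linear_isometry F T"
  shows "wtF F (T x) = wtF F x"
proof -
  interpret Vector_Spaces.linear "(*s)" "(*s)" T using assms by (simp add: linear_isometry_def)
  have "dF F (T x) (T 0) = dF F x 0"
    using assms unfolding linear_isometry_def by blast
  then show ?thesis by (simp add: dF_def zero)
qed

lemma linear_isometry_surj:
  fixes T :: "('a::{field,finite})^('n::finite) \<Rightarrow> 'a^'n"
  assumes "is_covering F" "linear_isometry F T"
  shows "surj T"
proof (rule finite_UNIV_inj_surj)
  show "inj T"
  proof (rule injI)
    fix x y assume "T x = T y"
    have "wtF F (x - y) = dF F (T x) (T y)"
      using assms(2) by (simp add: linear_isometry_def dF_def)
    also have "\<dots> = wtF F (0 :: 'a^'n)" using \<open>T x = T y\<close> by (simp add: dF_def)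
    also have "\<dots> = 0" by (simp add: wtF_eq_0_iff[OF assms(1)])
    finally show "x = y" by (simp add: wtF_eq_0_iff[OF assms(1)])
  qed
qed simp

lemma supp_add_coord_fill:
  fixes u :: "('a::{monoid_add,zero_neq_one})^'n"
  shows "\<exists>v\<in>coord_space B. supp (u + v) = B \<union> supp u"
proof
  let ?v = "\<chi> i. if i \<in> B \<and> u $ i = 0 then 1 else (0 :: 'a)"
  show "?v \<in> coord_space B" by (auto simp: coord_space_def supp_def)
  show "supp (u + ?v) = B \<union> supp u" by (auto simp: supp_def)
qed

lemma not_MacWilliams_EP_if_card_less:
  fixes F :: "('n::finite) set set"
  assumes cov: "is_covering F" and nr: "no_redundant F"
    and AF: "A \<in> F" and BF: "B \<in> F" and less: "card B < card A"
  shows "\<not> MacWilliams_EP F TYPE('a::{field,finite})"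
proof
  assume "MacWilliams_EP F TYPE('a)"
  obtain f where f: "inj_on f B" "f ` B \<subseteq> A"
    using card_le_inj[of B A] less by auto
  then have "f ` B \<noteq> A" using less card_image[OF f(1)] by auto
  with f(2) obtain a where a: "a \<in> A" "a \<notin> f ` B" by blast
  let ?t = "coord_embed f B :: 'a^'n \<Rightarrow> 'a^'n"
  obtain T where T: "linear_isometry F T" and T_ext: "\<forall>c\<in>coord_space B. T c = ?t c"
    using \<open>MacWilliams_EP F TYPE('a)\<close> local_equiv_coord_embed[OF cov AF BF f]
      linear_code_coord_space unfolding MacWilliams_EP_def by blast
  interpret Vector_Spaces.linear "(*s)" "(*s)" T using T by (simp add: linear_isometry_def)
  from surjD[OF linear_isometry_surj[OF cov T], of "axis a 1"]
  obtain u where u: "T u = axis a 1" by auto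
  obtain v where v: "v \<in> coord_space B" "supp (u + v) = B \<union> supp u"
    using supp_add_coord_fill by blast
  have "T (u + v) \<in> coord_space A"
    using supp_coord_embed[of f B v] f(2) a(1) T_ext v(1)
    by (auto simp: add u coord_space_def supp_def axis_def)
  then have "wtF F (T (u + v)) \<le> 1" by (simp add: wtF_coord_space[OF cov AF])
  then have "wtF F (u + v) \<le> 1" by (simp add: linear_isometry_preserves_wtF[OF T])
  then obtain C where C: "C \<in> F" "B \<union> supp u \<subseteq> C"
    unfolding wtF_le_1_iff[OF cov] v(2) by blast
  have "a \<in> supp (T u)" by (simp add: u supp_def)
  then have "\<not> supp u \<subseteq> B"
    using T_ext a(2) supp_coord_embed[of f B u] by (auto simp: coord_space_def)
  with C have "B \<subset> C" by blast
  with nr BF C(1) show False unfolding no_redundant_def by blast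
qed

theorem proposition7:
  fixes F :: "('n::finite) set set"
  assumes "is_covering F"
    and "no_redundant F"
    and "A \<in> F" and "B \<in> F" and "card A \<noteq> card B"
  shows "\<not> MacWilliams_EP F TYPE('a::{field,finite})"
proof (cases "card B < card A")
  case True
  then show ?thesis by (rule not_MacWilliams_EP_if_card_less[OF assms(1-4)])
next
  case False
  with assms(5) have "card A < card B" by simp
  then show ?thesis by (rule not_MacWilliams_EP_if_card_less[OF assms(1,2,4,3)])
qed

end
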